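(* Let $a\in L^1(I)$ and suppose that the periodic problem on $J$ with potential $\tilde a$ is nonresonant and $G_P[\tilde a,2T]\ge 0$ on $J\times J$. Let $\sigma_1,\sigma_2\in L^1(I)$, let $u_N$ be the unique solution of the Neumann problem $u''+a(t)u=\sigma_1(t)$ a.e. on $I$, $u'(0)=u'(T)=0$, and let $u_D$ be the unique solution of the Dirichlet problem $u''+a(t)u=\sigma_2(t)$ a.e. on $I$, $u(0)=u(T)=0$. If $|\sigma_2(t)|\le\sigma_1(t)$ for a.e. $t\in I$, then $|u_D(t)|\le u_N(t)$ for all $t\in I$.
   Context: Fix $T>0$ and put $I=[0,T]$, $J=[0,2T]$. Solutions are functions $u\in C^1$ with $u'$ absolutely continuous on the interval in question. $\tilde a$ is the even extension of $a$ to $J$: $\tilde a(t)=a(t)$ on $[0,T]$, $\tilde a(t)=a(2T-t)$ on $(T,2T]$. The periodic problem on $J$ is $u''+\tilde a(t)u=\tilde\sigma(t)$ a.e. on $J$, $u(0)=u(2T)$, $u'(0)=u'(2T)$; it is nonresonant if for $\tilde\sigma=0$ it has only the trivial solution, and then $G_P[\tilde a,2T]$ is its Green's function: the continuous function on $J\times J$ such that for each $\tilde\sigma\in L^1(J)$ the unique solution is $u(t)=\int_0^{2T}G_P[\tilde a,2T](t,s)\tilde\sigma(s)\,ds$. (If this problem is nonresonant, the Neumann and Dirichlet problems on $I$ with potential $a$ are uniquely solvable too.) *)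

theory Defs
  imports "HOL-Analysis.Analysis"
begin

(* The library's absolutely_continuous is about measures; this is the classical epsilon-delta
   notion for functions. A pair (x, y) in D stands for the interval [x, y]. *)
definition abs_cont_on :: "real set \<Rightarrow> (real \<Rightarrow> real) \<Rightarrow> bool" where
  "abs_cont_on S f \<longleftrightarrow>
     (\<forall>\<epsilon>>0. \<exists>\<delta>>0. \<forall>D :: (real \<times> real) set.
        finite D \<and> (\<forall>(x, y)\<in>D. x \<le> y \<and> {x..y} \<subseteq> S)
          \<and> disjoint_family_on (\<lambda>(x, y). {x<..<y}) D
          \<and> (\<Sum>(x, y)\<in>D. y - x) < \<delta>
        \<longrightarrow> (\<Sum>(x, y)\<in>D. \<bar>f y - f x\<bar>) < \<epsilon>)"

(* u solves u'' + a u = \<sigma> a.e. on [c, d], and v is u' on [c, d] (one-sided at the end points).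
   Absolute continuity of v includes its continuity, so u is C^1. *)
definition ode_solution ::
  "real \<Rightarrow> real \<Rightarrow> (real \<Rightarrow> real) \<Rightarrow> (real \<Rightarrow> real) \<Rightarrow> (real \<Rightarrow> real) \<Rightarrow> (real \<Rightarrow> real) \<Rightarrow> bool" where
  "ode_solution c d a \<sigma> u v \<longleftrightarrow>
     (\<forall>t\<in>{c..d}. (u has_real_derivative v t) (at t within {c..d}))
     \<and> abs_cont_on {c..d} v
     \<and> (AE t\<in>{c..d} in lebesgue.
          \<exists>w. (v has_real_derivative w) (at t within {c..d}) \<and> w + a t * u t = \<sigma> t)"

definition neumann_solution ::
  "real \<Rightarrow> (real \<Rightarrow> real) \<Rightarrow> (real \<Rightarrow> real) \<Rightarrow> (real \<Rightarrow> real) \<Rightarrow> bool" where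
  "neumann_solution T a \<sigma> u \<longleftrightarrow> (\<exists>v. ode_solution 0 T a \<sigma> u v \<and> v 0 = 0 \<and> v T = 0)"

definition dirichlet_solution ::
  "real \<Rightarrow> (real \<Rightarrow> real) \<Rightarrow> (real \<Rightarrow> real) \<Rightarrow> (real \<Rightarrow> real) \<Rightarrow> bool" where
  "dirichlet_solution T a \<sigma> u \<longleftrightarrow> (\<exists>v. ode_solution 0 T a \<sigma> u v \<and> u 0 = 0 \<and> u T = 0)"

definition periodic_solution ::
  "real \<Rightarrow> (real \<Rightarrow> real) \<Rightarrow> (real \<Rightarrow> real) \<Rightarrow> (real \<Rightarrow> real) \<Rightarrow> bool" where
  "periodic_solution L a \<sigma> u \<longleftrightarrow> (\<exists>v. ode_solution 0 L a \<sigma> u v \<and> u 0 = u L \<and> v 0 = v L)"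

definition periodic_nonresonant :: "real \<Rightarrow> (real \<Rightarrow> real) \<Rightarrow> bool" where
  "periodic_nonresonant L a \<longleftrightarrow>
     (\<forall>u. periodic_solution L a (\<lambda>_. 0) u \<longrightarrow> (\<forall>t\<in>{0..L}. u t = 0))"

(* G is the Green's function of the periodic problem on [0, L]. Functions are only determined on
   [0, L], so "the unique solution is ..." reads: u is a solution iff it agrees with the integral
   there; in particular the integral is itself a solution. *)
definition is_periodic_green :: "real \<Rightarrow> (real \<Rightarrow> real) \<Rightarrow> (real \<Rightarrow> real \<Rightarrow> real) \<Rightarrow> bool" where
  "is_periodic_green L a G \<longleftrightarrow>
     continuous_on ({0..L} \<times> {0..L}) (\<lambda>(t, s). G t s)
     \<and> (\<forall>\<sigma>. \<sigma> absolutely_integrable_on {0..L} \<longrightarrow>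
          (\<forall>u. periodic_solution L a \<sigma> u \<longleftrightarrow>
             (\<forall>t\<in>{0..L}. u t = (LINT s:{0..L}|lebesgue. G t s * \<sigma> s))))"

definition even_extension :: "real \<Rightarrow> (real \<Rightarrow> real) \<Rightarrow> real \<Rightarrow> real" where
  "even_extension T a t = (if t \<le> T then a t else a (2 * T - t))"

end

theory Submission
  imports Defs
begin

text \<open>
  Why the comparison holds. Reflecting in \<open>T\<close> turns both boundary value problems on \<open>[0, T]\<close>
  into the same periodic problem on \<open>[0, 2 T]\<close>: the Neumann solution extends evenly (its
  derivative vanishes at \<open>T\<close>, so the extension is still \<open>C\<^sup>1\<close>), the Dirichlet solution extends
  oddly (its value vanishes at \<open>T\<close>), and in both cases the conditions at \<open>0\<close> become
  periodicity. The extended potential is the even one both times, and the right-hand sides are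
  the even extension \<open>s\<^sub>1\<close> of \<open>\<sigma>\<^sub>1\<close> and the odd extension \<open>s\<^sub>2\<close> of \<open>\<sigma>\<^sub>2\<close>, so that
  \<open>\<bar>s\<^sub>2\<bar> \<le> s\<^sub>1\<close> almost everywhere. Both solutions are therefore integrals against one
  nonnegative kernel \<open>G\<close>, and
  \<open>\<bar>\<integral> G s\<^sub>2\<bar> \<le> \<integral> G \<bar>s\<^sub>2\<bar> \<le> \<integral> G s\<^sub>1\<close>.

  The two reflections differ only in a sign \<open>e\<close>, so one statement,
  \<open>ode_solution_reflect_extend\<close>, serves both. Its delicate part is the absolute continuity of
  the glued derivative. Instead of cutting families of intervals at \<open>T\<close>, the glued function is
  dominated by two clamped functions, \<open>v (min t T)\<close> and \<open>v (min T (2 T - t))\<close>, each of which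
  is a monotone 1-Lipschitz reparametrisation of \<open>v\<close> defined on all of \<open>[0, 2 T]\<close>.
\<close>

section \<open>Absolute continuity\<close>

text \<open>
  Domination of increments replaces separate closure properties for sums, constant factors and
  constant shifts.
\<close>

lemma abs_cont_on_dominated:
  assumes f: "abs_cont_on S f" and g: "abs_cont_on S g"
    and le: "\<And>x y. x \<in> S \<Longrightarrow> y \<in> S \<Longrightarrow> \<bar>h y - h x\<bar> \<le> \<bar>f y - f x\<bar> + \<bar>g y - g x\<bar>"
  shows "abs_cont_on S h"
  unfolding abs_cont_on_def
proof (intro allI impI)
  fix \<epsilon> :: real assume "\<epsilon> > 0"
  then have "\<epsilon> / 2 > 0" by simp
  with f obtain \<delta>1 where "\<delta>1 > 0"
    and d1: "\<And>D. finite D \<Longrightarrow> (\<forall>(x, y)\<in>D. x \<le> y \<and> {x..y} \<subseteq> S) \<Longrightarrow>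
        disjoint_family_on (\<lambda>(x, y). {x<..<y}) D \<Longrightarrow> (\<Sum>(x, y)\<in>D. y - x) < \<delta>1 \<Longrightarrow>
        (\<Sum>(x, y)\<in>D. \<bar>f y - f x\<bar>) < \<epsilon> / 2"
    unfolding abs_cont_on_def by meson
  from g \<open>\<epsilon> / 2 > 0\<close> obtain \<delta>2 where "\<delta>2 > 0"
    and d2: "\<And>D. finite D \<Longrightarrow> (\<forall>(x, y)\<in>D. x \<le> y \<and> {x..y} \<subseteq> S) \<Longrightarrow>
        disjoint_family_on (\<lambda>(x, y). {x<..<y}) D \<Longrightarrow> (\<Sum>(x, y)\<in>D. y - x) < \<delta>2 \<Longrightarrow>
        (\<Sum>(x, y)\<in>D. \<bar>g y - g x\<bar>) < \<epsilon> / 2"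
    unfolding abs_cont_on_def by meson
  show "\<exists>\<delta>>0. \<forall>D. finite D \<and> (\<forall>(x, y)\<in>D. x \<le> y \<and> {x..y} \<subseteq> S) \<and>
      disjoint_family_on (\<lambda>(x, y). {x<..<y}) D \<and> (\<Sum>(x, y)\<in>D. y - x) < \<delta> \<longrightarrow>
      (\<Sum>(x, y)\<in>D. \<bar>h y - h x\<bar>) < \<epsilon>"
  proof (intro exI[of _ "min \<delta>1 \<delta>2"] conjI allI impI)
    show "0 < min \<delta>1 \<delta>2" using \<open>\<delta>1 > 0\<close> \<open>\<delta>2 > 0\<close> by simp
    fix D :: "(real \<times> real) set"
    assume D: "finite D \<and> (\<forall>(x, y)\<in>D. x \<le> y \<and> {x..y} \<subseteq> S) \<and>
      disjoint_family_on (\<lambda>(x, y). {x<..<y}) D \<and> (\<Sum>(x, y)\<in>D. y - x) < min \<delta>1 \<delta>2"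
    have "(\<Sum>(x, y)\<in>D. \<bar>h y - h x\<bar>) \<le> (\<Sum>(x, y)\<in>D. \<bar>f y - f x\<bar> + \<bar>g y - g x\<bar>)"
    proof (rule sum_mono)
      fix p assume "p \<in> D"
      obtain x y where p: "p = (x, y)" by fastforce
      have "x \<le> y" "{x..y} \<subseteq> S" using D \<open>p \<in> D\<close> p by auto
      then have "x \<in> S" "y \<in> S" by auto
      then show "(case p of (x, y) \<Rightarrow> \<bar>h y - h x\<bar>)
          \<le> (case p of (x, y) \<Rightarrow> \<bar>f y - f x\<bar> + \<bar>g y - g x\<bar>)"
        using le p by simp
    qed
    also have "\<dots> = (\<Sum>(x, y)\<in>D. \<bar>f y - f x\<bar>) + (\<Sum>(x, y)\<in>D. \<bar>g y - g x\<bar>)"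
      by (simp add: sum.distrib case_prod_beta)
    also have "\<dots> < \<epsilon>"
      using d1[of D] d2[of D] D by fastforce
    finally show "(\<Sum>(x, y)\<in>D. \<bar>h y - h x\<bar>) < \<epsilon>" .
  qed
qed

text \<open>
  A monotone \<open>g\<close> maps non-overlapping intervals to non-overlapping ones, and a 1-Lipschitz \<open>g\<close>
  does not lengthen them; hence the \<open>\<delta>\<close> that works for \<open>f\<close> also works for \<open>f \<circ> g\<close>.
  Intervals that \<open>g\<close> collapses to a point must be dropped before the images are collected into a
  set: they contribute nothing to the sum, and without them distinct intervals have distinct
  images.
\<close>

lemma abs_cont_on_compose_monotone:
  fixes g :: "real \<Rightarrow> real"
  assumes f: "abs_cont_on {a..b} f"
    and mono: "mono_on {c..d} g \<or> antimono_on {c..d} g"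
    and lip: "\<And>x y. x \<in> {c..d} \<Longrightarrow> y \<in> {c..d} \<Longrightarrow> \<bar>g y - g x\<bar> \<le> \<bar>y - x\<bar>"
    and maps: "g ` {c..d} \<subseteq> {a..b}"
  shows "abs_cont_on {c..d} (\<lambda>t. f (g t))"
  unfolding abs_cont_on_def
proof (intro allI impI)
  fix \<epsilon> :: real assume "\<epsilon> > 0"
  with f obtain \<delta> where "\<delta> > 0"
    and \<delta>: "\<And>D. finite D \<Longrightarrow> (\<forall>(x, y)\<in>D. x \<le> y \<and> {x..y} \<subseteq> {a..b}) \<Longrightarrow>
        disjoint_family_on (\<lambda>(x, y). {x<..<y}) D \<Longrightarrow> (\<Sum>(x, y)\<in>D. y - x) < \<delta> \<Longrightarrow>
        (\<Sum>(x, y)\<in>D. \<bar>f y - f x\<bar>) < \<epsilon>"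
    unfolding abs_cont_on_def by meson
  define im where "im = (\<lambda>(x, y). (min (g x) (g y), max (g x) (g y)))"
  show "\<exists>\<delta>>0. \<forall>D. finite D \<and> (\<forall>(x, y)\<in>D. x \<le> y \<and> {x..y} \<subseteq> {c..d}) \<and>
      disjoint_family_on (\<lambda>(x, y). {x<..<y}) D \<and> (\<Sum>(x, y)\<in>D. y - x) < \<delta> \<longrightarrow>
      (\<Sum>(x, y)\<in>D. \<bar>f (g y) - f (g x)\<bar>) < \<epsilon>"
  proof (intro exI[of _ \<delta>] conjI allI impI)
    show "0 < \<delta>" by fact
    fix D :: "(real \<times> real) set"
    assume "finite D \<and> (\<forall>(x, y)\<in>D. x \<le> y \<and> {x..y} \<subseteq> {c..d}) \<and>
      disjoint_family_on (\<lambda>(x, y). {x<..<y}) D \<and> (\<Sum>(x, y)\<in>D. y - x) < \<delta>"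
    then have fin: "finite D" and disj: "disjoint_family_on (\<lambda>(x, y). {x<..<y}) D"
      and len: "(\<Sum>(x, y)\<in>D. y - x) < \<delta>"
      and sub: "\<And>x y. (x, y) \<in> D \<Longrightarrow> x \<le> y \<and> {x..y} \<subseteq> {c..d}"
      by auto
    have ends: "x \<le> y" "x \<in> {c..d}" "y \<in> {c..d}" if "(x, y) \<in> D" for x y
      using sub[OF that] by auto
    define D' where "D' = {(x, y) \<in> D. g x \<noteq> g y}"
    have D'D: "D' \<subseteq> D" and fin': "finite D'"
      using fin by (auto simp: D'_def intro: rev_finite_subset)
    have images_disjoint: "{fst (im p)<..<snd (im p)} \<inter> {fst (im q)<..<snd (im q)} = {}"
      if "p \<in> D'" "q \<in> D'" "p \<noteq> q" for p q
    proof -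
      obtain x y x' y' where p: "p = (x, y)" and q: "q = (x', y')" by fastforce
      have xy: "(x, y) \<in> D" "g x \<noteq> g y" and xy': "(x', y') \<in> D" "g x' \<noteq> g y'"
        using that p q by (auto simp: D'_def)
      have "x < y" "x' < y'"
        using ends(1)[OF xy(1)] ends(1)[OF xy'(1)] xy(2) xy'(2) by (auto simp: less_le)
      have "{x<..<y} \<inter> {x'<..<y'} = {}"
        using disj xy(1) xy'(1) \<open>p \<noteq> q\<close> p q unfolding disjoint_family_on_def by fastforce
      have "y \<le> x' \<or> y' \<le> x"
      proof (rule ccontr)
        assume "\<not> (y \<le> x' \<or> y' \<le> x)"
        then have "max x x' < min y y'" using \<open>x < y\<close> \<open>x' < y'\<close> by auto
        then obtain z where "max x x' < z" "z < min y y'" using dense by blast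
        then have "z \<in> {x<..<y} \<inter> {x'<..<y'}" by auto
        then show False using \<open>{x<..<y} \<inter> {x'<..<y'} = {}\<close> by blast
      qed
      moreover have "max (g x) (g y) \<le> min (g x') (g y') \<or> max (g x') (g y') \<le> min (g x) (g y)"
        if yx: "y \<le> x'" and "x \<le> y" "x' \<le> y'" "x \<in> {c..d}" "y' \<in> {c..d}" for x y x' y'
      proof -
        have "y \<in> {c..d}" "x' \<in> {c..d}" using that by auto
        then show ?thesis
          using mono
        proof (elim disjE)
          assume m: "mono_on {c..d} g"
          have "g x \<le> g y" "g y \<le> g x'" "g x' \<le> g y'"
            using that \<open>y \<in> {c..d}\<close> \<open>x' \<in> {c..d}\<close>
            by (auto intro!: mono_onD[OF m])
          then show ?thesis by auto
        next
          assume m: "antimono_on {c..d} g"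
          have "g y \<le> g x" "g x' \<le> g y" "g y' \<le> g x'"
            using that \<open>y \<in> {c..d}\<close> \<open>x' \<in> {c..d}\<close>
            by (auto intro!: monotone_onD[OF m])
          then show ?thesis by auto
        qed
      qed
      ultimately have
        "max (g x) (g y) \<le> min (g x') (g y') \<or> max (g x') (g y') \<le> min (g x) (g y)"
        using ends[OF xy(1)] ends[OF xy'(1)] by blast
      then show ?thesis
        unfolding p q im_def by auto
    qed
    have nonempty: "{fst (im p)<..<snd (im p)} \<noteq> {}" if "p \<in> D'" for p
      using that by (auto simp: D'_def im_def)
    have inj: "inj_on im D'"
      by (rule inj_onI) (metis Int_absorb images_disjoint nonempty)
    have im_sub: "\<forall>(x, y)\<in>im ` D'. x \<le> y \<and> {x..y} \<subseteq> {a..b}"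
    proof clarify
      fix x y z w assume "(z, w) = im (x, y)" "(x, y) \<in> D'"
      then have zw: "z = min (g x) (g y)" "w = max (g x) (g y)" and "(x, y) \<in> D"
        using D'D by (auto simp: im_def)
      have "g x \<in> {a..b}" "g y \<in> {a..b}"
        using maps ends[OF \<open>(x, y) \<in> D\<close>] by blast+
      then show "z \<le> w \<and> {z..w} \<subseteq> {a..b}" unfolding zw by auto
    qed
    have im_disj: "disjoint_family_on (\<lambda>(x, y). {x<..<y}) (im ` D')"
      unfolding disjoint_family_on_def
      using images_disjoint by (auto simp: case_prod_beta)
    have "(\<Sum>(x, y)\<in>im ` D'. y - x) = (\<Sum>(x, y)\<in>D'. \<bar>g y - g x\<bar>)"
      by (subst sum.reindex[OF inj]) (auto simp: im_def case_prod_beta intro!: sum.cong)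
    also have "\<dots> \<le> (\<Sum>(x, y)\<in>D'. y - x)"
    proof (rule sum_mono, clarify)
      fix x y assume "(x, y) \<in> D'"
      then have "(x, y) \<in> D" using D'D by auto
      then show "\<bar>g y - g x\<bar> \<le> y - x" using lip[of x y] ends[of x y] by fastforce
    qed
    also have "\<dots> \<le> (\<Sum>(x, y)\<in>D. y - x)"
      using fin D'D ends(1) by (intro sum_mono2) auto
    finally have im_len: "(\<Sum>(x, y)\<in>im ` D'. y - x) < \<delta>" using len by simp
    have "(\<Sum>(x, y)\<in>D. \<bar>f (g y) - f (g x)\<bar>) = (\<Sum>(x, y)\<in>D'. \<bar>f (g y) - f (g x)\<bar>)"
      using fin D'D by (intro sum.mono_neutral_right) (auto simp: D'_def)
    also have "\<dots> = (\<Sum>(x, y)\<in>im ` D'. \<bar>f y - f x\<bar>)"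
      by (subst sum.reindex[OF inj])
        (auto simp: im_def case_prod_beta min_def max_def intro!: sum.cong)
    also have "\<dots> < \<epsilon>"
      using \<delta>[OF _ im_sub im_disj im_len] fin' by simp
    finally show "(\<Sum>(x, y)\<in>D. \<bar>f (g y) - f (g x)\<bar>) < \<epsilon>" .
  qed
qed

section \<open>Reflection in the right end point\<close>

text \<open>
  The factor \<open>e\<close> is \<open>1\<close> for the even and \<open>-1\<close> for the odd extension about \<open>T\<close>. Oddness can
  fail at the single point \<open>T\<close>, unless \<open>f T = 0\<close>.
\<close>

definition reflect_extend :: "real \<Rightarrow> real \<Rightarrow> (real \<Rightarrow> real) \<Rightarrow> real \<Rightarrow> real" where
  "reflect_extend e T f t = (if t \<le> T then f t else e * f (2 * T - t))"

lemma AE_lebesgue_reflect: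
  assumes "AE t in lebesgue. P t"
  shows "AE t in lebesgue. P (c - t :: real)"
proof (rule AE_distrD[of _ lebesgue lebesgue])
  show "(\<lambda>t. c - t) \<in> measurable lebesgue lebesgue"
    using lebesgue_affine_measurable[of "\<lambda>_::real. -1" c] by simp
  have "distr lebesgue lebesgue (\<lambda>t. c - t) = (lebesgue :: real measure)"
    using lebesgue_real_affine[of "-1" c] by (simp add: density_1)
  with assms show "AE t in distr lebesgue lebesgue (\<lambda>t. c - t). P t"
    by (simp only:)
qed

text \<open>
  A property that holds almost everywhere on the left half carries over to both halves. The end
  points and the centre are left out, so \<open>P\<close> may involve one-sided derivatives: at the remaining
  points the derivative within an interval is the two-sided one.
\<close>

lemma AE_both_halves:
  fixes T :: real
  assumes P: "AE t\<in>{0..T} in lebesgue. P t"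
    and left: "\<And>t. 0 < t \<Longrightarrow> t < T \<Longrightarrow> P t \<Longrightarrow> Q t"
    and right: "\<And>t. T < t \<Longrightarrow> t < 2 * T \<Longrightarrow> P (2 * T - t) \<Longrightarrow> Q t"
  shows "AE t\<in>{0..2 * T} in lebesgue. Q t"
proof -
  have ne: "AE t in lebesgue. t \<noteq> c" for c :: real
    by (rule AE_completion[OF AE_lborel_singleton])
  show ?thesis
    using P AE_lebesgue_reflect[OF P, of "2 * T"] ne[of 0] ne[of T] ne[of "2 * T"]
  proof eventually_elim
    case (elim t)
    show ?case
    proof
      assume "t \<in> {0..2 * T}"
      then consider "0 < t" "t < T" | "T < t" "t < 2 * T"
        using elim by fastforce
      then show "Q t"
        using elim left right by cases auto
    qed
  qed
qed

lemma absolutely_integrable_reflect_extend: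
  assumes T: "T > 0" and f: "f absolutely_integrable_on {0..T}"
  shows "reflect_extend e T f absolutely_integrable_on {0..2 * T}"
proof (rule absolutely_integrable_on_combine)
  show "reflect_extend e T f absolutely_integrable_on {0..T}"
    using f by (rule absolutely_integrable_spike[of _ _ "{}"]) (auto simp: reflect_extend_def)
  have "integrable lebesgue (\<lambda>t. indicator {0..T} (2 * T + (-1) * t) *\<^sub>R f (2 * T + (-1) * t))"
    using f unfolding set_integrable_def by (rule lebesgue_integrable_real_affine) simp
  also have "(\<lambda>t. indicator {0..T} (2 * T + (-1) * t) *\<^sub>R f (2 * T + (-1) * t))
      = (\<lambda>t. indicator {T..2 * T} t *\<^sub>R f (2 * T - t))"
    by (auto simp: fun_eq_iff indicator_def)
  finally have "(\<lambda>t. e * f (2 * T - t)) absolutely_integrable_on {T..2 * T}"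
    by (intro set_integrable_mult_right) (simp add: set_integrable_def)
  then show "reflect_extend e T f absolutely_integrable_on {T..2 * T}"
    by (rule absolutely_integrable_spike[of _ _ "{T}"]) (auto simp: reflect_extend_def)
qed (use T in auto)

text \<open>
  The chain rule gives the reflected derivative a factor \<open>-1\<close>, so the derivative of an even
  function extends oddly and vice versa. The gluing conditions say that value and slope of the
  two halves agree at \<open>T\<close>: for \<open>e = 1\<close> the slope has to vanish, for \<open>e = -1\<close> the value.
\<close>

lemma ode_solution_reflect_extend:
  assumes T: "T > 0" and sol: "ode_solution 0 T a \<sigma> u v"
    and e: "e * e = 1" and uT: "e * u T = u T" and vT: "- e * v T = v T"
  shows "ode_solution 0 (2 * T) (even_extension T a) (reflect_extend e T \<sigma>)
    (reflect_extend e T u) (reflect_extend (- e) T v)"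
proof -
  have u: "\<And>t. t \<in> {0..T} \<Longrightarrow> (u has_real_derivative v t) (at t within {0..T})"
    and v: "abs_cont_on {0..T} v"
    and ode: "AE t\<in>{0..T} in lebesgue.
      \<exists>w. (v has_real_derivative w) (at t within {0..T}) \<and> w + a t * u t = \<sigma> t"
    using sol by (auto simp: ode_solution_def)
  have abs_e: "\<bar>e\<bar> = 1"
    using e by (simp add: abs_square_eq_1 flip: power2_eq_square)
  have deriv: "(reflect_extend e T u has_real_derivative reflect_extend (- e) T v t)
      (at t within {0..2 * T})" if t: "t \<in> {0..2 * T}" for t
  proof -
    have union: "{0..2 * T} = {0..T} \<union> {T..2 * T}" using T by auto
    have cl: "closure {0..T} \<inter> closure {T..2 * T} = {T}" using T by auto
    have right: "((\<lambda>t. e * u (2 * T - t)) has_real_derivative - e * v (2 * T - t))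
        (at t within {T..2 * T})" if "t \<in> {T..2 * T}" for t
    proof -
      have img: "(\<lambda>t. 2 * T - t) ` {T..2 * T} = {0..T}"
        by (simp add: image_diff_atLeastAtMost)
      have "((\<lambda>t. 2 * T - t) has_real_derivative - 1) (at t within {T..2 * T})"
        by (auto intro!: derivative_eq_intros)
      moreover have "(u has_real_derivative v (2 * T - t))
          (at (2 * T - t) within (\<lambda>t. 2 * T - t) ` {T..2 * T})"
        unfolding img using u[of "2 * T - t"] that by auto
      ultimately have "((\<lambda>t. u (2 * T - t)) has_real_derivative v (2 * T - t) * - 1)
          (at t within {T..2 * T})"
        using DERIV_image_chain[of u "v (2 * T - t)" "\<lambda>t. 2 * T - t" t "{T..2 * T}" "- 1"]
        by (simp add: o_def)
      from DERIV_cmult[OF this, of e] show ?thesis by simp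
    qed
    have "((\<lambda>t. if t \<in> {0..T} then u t else e * u (2 * T - t)) has_vector_derivative
        (if t \<in> {0..T} then v t else - e * v (2 * T - t))) (at t within {0..2 * T})"
    proof (rule has_vector_derivative_If_within_closures[where T = "{T..2 * T}"])
      show "t \<in> {0..T} \<union> {T..2 * T}" using t union by blast
      show "{0..2 * T} = {0..T} \<union> {T..2 * T}" by (rule union)
      have ab: "{0..T} \<union> {T} = {0..T}" "{T..2 * T} \<union> {T} = {T..2 * T}" using T by auto
      show "(u has_vector_derivative v t)
          (at t within {0..T} \<union> closure {0..T} \<inter> closure {T..2 * T})"
        if "t \<in> {0..T} \<union> closure {0..T} \<inter> closure {T..2 * T}"
        using u that unfolding cl ab has_real_derivative_iff_has_vector_derivative by blast
      show "((\<lambda>t. e * u (2 * T - t)) has_vector_derivative - e * v (2 * T - t))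
          (at t within {T..2 * T} \<union> closure {0..T} \<inter> closure {T..2 * T})"
        if "t \<in> {T..2 * T} \<union> closure {0..T} \<inter> closure {T..2 * T}"
        using right that unfolding cl ab has_real_derivative_iff_has_vector_derivative by blast
      show "u t = e * u (2 * T - t)" "v t = - e * v (2 * T - t)"
        if "t \<in> closure {0..T}" "t \<in> closure {T..2 * T}"
      proof -
        have "t = T" using that by auto
        then show "u t = e * u (2 * T - t)" "v t = - e * v (2 * T - t)" using uT vT by auto
      qed
    qed
    then have "((\<lambda>t. if t \<in> {0..T} then u t else e * u (2 * T - t)) has_real_derivative
        reflect_extend (- e) T v t) (at t within {0..2 * T})"
      using t by (auto simp: has_real_derivative_iff_has_vector_derivative reflect_extend_def
          split: if_splits)
    then show ?thesis
      by (rule has_field_derivative_transform_within[OF _ zero_less_one t])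
        (auto simp: reflect_extend_def)
  qed
  have ac: "abs_cont_on {0..2 * T} (reflect_extend (- e) T v)"
  proof (rule abs_cont_on_dominated)
    show "abs_cont_on {0..2 * T} (\<lambda>t. v (min t T))"
      using T by (intro abs_cont_on_compose_monotone[OF v] disjI1)
        (auto simp: monotone_on_def min_def)
    show "abs_cont_on {0..2 * T} (\<lambda>t. v (min T (2 * T - t)))"
      using T by (intro abs_cont_on_compose_monotone[OF v] disjI2)
        (auto simp: monotone_on_def min_def)
    \<comment> \<open>On the half where a clamped function does not follow \<open>v\<close> or its reflection, it has the
      constant value \<open>v T\<close>; subtracting \<open>v T\<close> cancels that contribution.\<close>
    have split: "reflect_extend (- e) T v t = v (min t T) - e * v (min T (2 * T - t)) - v T" for t
      using vT by (auto simp: reflect_extend_def min_def)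
    show "\<bar>reflect_extend (- e) T v y - reflect_extend (- e) T v x\<bar>
        \<le> \<bar>v (min y T) - v (min x T)\<bar> + \<bar>v (min T (2 * T - y)) - v (min T (2 * T - x))\<bar>" for x y
    proof -
      have "reflect_extend (- e) T v y - reflect_extend (- e) T v x
          = (v (min y T) - v (min x T)) - e * (v (min T (2 * T - y)) - v (min T (2 * T - x)))"
        by (simp add: split algebra_simps)
      also have "\<bar>\<dots>\<bar> \<le> \<bar>v (min y T) - v (min x T)\<bar>
          + \<bar>e * (v (min T (2 * T - y)) - v (min T (2 * T - x)))\<bar>"
        by (rule abs_triangle_ineq4)
      finally show ?thesis by (simp add: abs_mult abs_e)
    qed
  qed
  have "AE t\<in>{0..2 * T} in lebesgue.
      \<exists>w. (reflect_extend (- e) T v has_real_derivative w) (at t within {0..2 * T})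
        \<and> w + even_extension T a t * reflect_extend e T u t = reflect_extend e T \<sigma> t"
    using ode
  proof (rule AE_both_halves)
    fix t assume t: "0 < t" "t < T"
      and "\<exists>w. (v has_real_derivative w) (at t within {0..T}) \<and> w + a t * u t = \<sigma> t"
    then obtain w where w: "(v has_real_derivative w) (at t)" "w + a t * u t = \<sigma> t"
      by (auto simp: at_within_Icc_at)
    have "(reflect_extend (- e) T v has_real_derivative w) (at t)"
      using w(1) by (rule has_field_derivative_transform_within_open[where S = "{..<T}"])
        (use t in \<open>auto simp: reflect_extend_def\<close>)
    then show "\<exists>w. (reflect_extend (- e) T v has_real_derivative w) (at t within {0..2 * T})
        \<and> w + even_extension T a t * reflect_extend e T u t = reflect_extend e T \<sigma> t"
      using w(2) t
      by (auto simp: even_extension_def reflect_extend_def intro: has_field_derivative_at_within)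
  next
    fix t assume t: "T < t" "t < 2 * T"
      and "\<exists>w. (v has_real_derivative w) (at (2 * T - t) within {0..T})
        \<and> w + a (2 * T - t) * u (2 * T - t) = \<sigma> (2 * T - t)"
    then obtain w where w: "(v has_real_derivative w) (at (2 * T - t))"
        "w + a (2 * T - t) * u (2 * T - t) = \<sigma> (2 * T - t)"
      by (auto simp: at_within_Icc_at)
    have "((\<lambda>t. - e * v (2 * T - t)) has_real_derivative e * w) (at t)"
      using w(1) by (auto intro!: derivative_eq_intros DERIV_chain2[of v])
    then have "(reflect_extend (- e) T v has_real_derivative e * w) (at t)"
      by (rule has_field_derivative_transform_within_open[where S = "{T<..}"])
        (use t in \<open>auto simp: reflect_extend_def\<close>)
    moreover have "e * w + a (2 * T - t) * (e * u (2 * T - t)) = e * \<sigma> (2 * T - t)"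
      by (simp add: distrib_left flip: w(2))
    ultimately show "\<exists>w. (reflect_extend (- e) T v has_real_derivative w) (at t within {0..2 * T})
        \<and> w + even_extension T a t * reflect_extend e T u t = reflect_extend e T \<sigma> t"
      using t
      by (auto simp: even_extension_def reflect_extend_def intro: has_field_derivative_at_within)
  qed
  with deriv ac show ?thesis
    by (auto simp: ode_solution_def)
qed

lemma neumann_solution_reflect_periodic:
  assumes "T > 0" "neumann_solution T a \<sigma> u"
  shows "periodic_solution (2 * T) (even_extension T a) (reflect_extend 1 T \<sigma>)
    (reflect_extend 1 T u)"
proof -
  obtain v where sol: "ode_solution 0 T a \<sigma> u v" and "v 0 = 0" "v T = 0"
    using assms(2) by (auto simp: neumann_solution_def)
  then have "ode_solution 0 (2 * T) (even_extension T a) (reflect_extend 1 T \<sigma>)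
      (reflect_extend 1 T u) (reflect_extend (- 1) T v)"
    using ode_solution_reflect_extend[OF \<open>T > 0\<close> sol, of 1] by simp
  then show ?thesis
    using \<open>v 0 = 0\<close> \<open>T > 0\<close> unfolding periodic_solution_def
    by (intro exI[of _ "reflect_extend (- 1) T v"]) (auto simp: reflect_extend_def)
qed

lemma dirichlet_solution_reflect_periodic:
  assumes "T > 0" "dirichlet_solution T a \<sigma> u"
  shows "periodic_solution (2 * T) (even_extension T a) (reflect_extend (- 1) T \<sigma>)
    (reflect_extend (- 1) T u)"
proof -
  obtain v where sol: "ode_solution 0 T a \<sigma> u v" and "u 0 = 0" "u T = 0"
    using assms(2) by (auto simp: dirichlet_solution_def)
  then have "ode_solution 0 (2 * T) (even_extension T a) (reflect_extend (- 1) T \<sigma>)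
      (reflect_extend (- 1) T u) (reflect_extend 1 T v)"
    using ode_solution_reflect_extend[OF \<open>T > 0\<close> sol, of "- 1"] by simp
  then show ?thesis
    using \<open>u 0 = 0\<close> \<open>T > 0\<close> unfolding periodic_solution_def
    by (intro exI[of _ "reflect_extend 1 T v"]) (auto simp: reflect_extend_def)
qed

section \<open>Comparison through the periodic Green's function\<close>

lemma periodic_green_comparison:
  assumes G: "is_periodic_green L a G" and nonneg: "\<forall>t\<in>{0..L}. \<forall>s\<in>{0..L}. G t s \<ge> 0"
    and int1: "\<sigma>\<^sub>1 absolutely_integrable_on {0..L}" and int2: "\<sigma>\<^sub>2 absolutely_integrable_on {0..L}"
    and sol1: "periodic_solution L a \<sigma>\<^sub>1 u\<^sub>1" and sol2: "periodic_solution L a \<sigma>\<^sub>2 u\<^sub>2"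
    and le: "AE t\<in>{0..L} in lebesgue. \<bar>\<sigma>\<^sub>2 t\<bar> \<le> \<sigma>\<^sub>1 t"
    and t: "t \<in> {0..L}"
  shows "\<bar>u\<^sub>2 t\<bar> \<le> u\<^sub>1 t"
proof -
  have "continuous_on {0..L} ((\<lambda>(t, s). G t s) \<circ> Pair t)"
    using G t unfolding is_periodic_green_def
    by (intro continuous_on_compose continuous_intros) (auto elim: continuous_on_subset)
  then have cont: "continuous_on {0..L} (G t)" by (simp add: o_def)
  have int: "(\<lambda>s. G t s * \<sigma> s) absolutely_integrable_on {0..L}"
    if "\<sigma> absolutely_integrable_on {0..L}" for \<sigma>
  proof (rule absolutely_integrable_bounded_measurable_product_real[OF _ _ _ that])
    show "G t \<in> borel_measurable (lebesgue_on {0..L})"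
      using cont by (rule continuous_imp_measurable_on_sets_lebesgue) simp
    show "bounded (G t ` {0..L})"
      using cont by (intro compact_imp_bounded compact_continuous_image) auto
  qed simp
  have u: "u t = (LINT s:{0..L}|lebesgue. G t s * \<sigma> s)"
    if "\<sigma> absolutely_integrable_on {0..L}" "periodic_solution L a \<sigma> u" for \<sigma> u
    using G that t unfolding is_periodic_green_def by blast
  have "\<bar>u\<^sub>2 t\<bar> \<le> (LINT s:{0..L}|lebesgue. \<bar>G t s * \<sigma>\<^sub>2 s\<bar>)"
    using set_integral_norm_bound[OF int[OF int2]] u[OF int2 sol2] by simp
  also have "\<dots> \<le> (LINT s:{0..L}|lebesgue. G t s * \<sigma>\<^sub>1 s)"
  proof (rule set_integral_mono_AE[OF set_integrable_abs[OF int[OF int2]] int[OF int1]])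
    show "AE s\<in>{0..L} in lebesgue. \<bar>G t s * \<sigma>\<^sub>2 s\<bar> \<le> G t s * \<sigma>\<^sub>1 s"
      using le nonneg t by (auto simp: abs_mult intro!: mult_left_mono elim!: eventually_mono)
  qed
  also have "\<dots> = u\<^sub>1 t"
    using u[OF int1 sol1] by simp
  finally show ?thesis .
qed

theorem theorem4p11:
  fixes T :: real
    and a \<sigma>\<^sub>1 \<sigma>\<^sub>2 u\<^sub>N u\<^sub>D :: "real \<Rightarrow> real"
    and G :: "real \<Rightarrow> real \<Rightarrow> real"
  assumes "T > 0"
    and "a absolutely_integrable_on {0..T}"
    and "periodic_nonresonant (2 * T) (even_extension T a)"
    and "is_periodic_green (2 * T) (even_extension T a) G"
    and "\<forall>t\<in>{0..2 * T}. \<forall>s\<in>{0..2 * T}. G t s \<ge> 0"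
    and "\<sigma>\<^sub>1 absolutely_integrable_on {0..T}"
    and "\<sigma>\<^sub>2 absolutely_integrable_on {0..T}"
    and "neumann_solution T a \<sigma>\<^sub>1 u\<^sub>N"
    and "dirichlet_solution T a \<sigma>\<^sub>2 u\<^sub>D"
    and "AE t\<in>{0..T} in lebesgue. \<bar>\<sigma>\<^sub>2 t\<bar> \<le> \<sigma>\<^sub>1 t"
  shows "\<forall>t\<in>{0..T}. \<bar>u\<^sub>D t\<bar> \<le> u\<^sub>N t"
proof
  fix t assume t: "t \<in> {0..T}"
  have le: "AE t\<in>{0..2 * T} in lebesgue.
      \<bar>reflect_extend (- 1) T \<sigma>\<^sub>2 t\<bar> \<le> reflect_extend 1 T \<sigma>\<^sub>1 t"
    using assms(10) by (rule AE_both_halves) (auto simp: reflect_extend_def)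
  have "\<bar>reflect_extend (- 1) T u\<^sub>D t\<bar> \<le> reflect_extend 1 T u\<^sub>N t"
    using t \<open>T > 0\<close>
    by (intro periodic_green_comparison[OF assms(4,5) _ _ _ _ le]
        absolutely_integrable_reflect_extend neumann_solution_reflect_periodic
        dirichlet_solution_reflect_periodic assms) auto
  then show "\<bar>u\<^sub>D t\<bar> \<le> u\<^sub>N t"
    using t by (simp add: reflect_extend_def)
qed

end
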